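(* Let $\mathbb{F}$ be a field of characteristic $>3$. Then $\mathfrak{sl}_2(\mathbb{F})$ has a COD, and this COD is unique up to conjugacy, if and only if $\mathbb{F}$ contains a primitive fourth root of unity.
   Context: $\mathfrak{sl}_n(\mathbb{F})$ denotes the Lie algebra of $n\times n$ traceless matrices over $\mathbb{F}$. A Cartan subalgebra is a nilpotent self-normalizing subalgebra. A classical Cartan subalgebra of $\mathfrak{L}=\mathfrak{sl}_n(\mathbb{F})$ (with $\ell=\mathrm{char}\,\mathbb{F}$) is an abelian Cartan subalgebra $H$ such that: (a) $\mathfrak{L}=\bigoplus_\alpha \mathfrak{L}_\alpha$ with $\mathfrak{L}_\alpha=\{x: [x,h]=\alpha(h)x\ \forall h\in H\}$ over linear functionals $\alpha$ on $H$ (roots); (b) for each root $\alpha\ne0$, $[\mathfrak{L}_\alpha,\mathfrak{L}_{-\alpha}]$ is one-dimensional; (c) for roots $\alpha,\beta$ with $\beta\neq0$, not all $\alpha+k\beta$ ($1\le k\le \ell-1$) are roots. The Killing form is $K(A,B)=2n\,\mathrm{Tr}(AB)$. A COD of $\mathfrak{sl}_n(\mathbb{F})$ is a vector space decomposition $\mathfrak{sl}_n(\mathbb{F})=H_0\oplus\cdots\oplus H_n$ into classical Cartan subalgebras that are pairwise orthogonal with respect to $K$. Two CODs are conjugate if there is a Lie algebra automorphism of $\mathfrak{sl}_n(\mathbb{F})$ mapping each component of the first decomposition onto exactly one component of the second. *)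

theory Defs
  imports "HOL-Analysis.Analysis"
begin

type_synonym ('a, 'n) sqmat = "'a^'n^'n"

definition smat :: "'a::field \<Rightarrow> 'a^'n^'n \<Rightarrow> 'a^'n^'n" where
  "smat c A = (\<chi> i j. c * A$i$j)"

definition lie_br :: "'a::field^'n^'n \<Rightarrow> 'a^'n^'n \<Rightarrow> 'a^'n^'n" where
  "lie_br A B = A ** B - B ** A"

definition sl :: "('a::field^'n^'n) set" where
  "sl = {A. trace A = 0}"

inductive_set span_mat :: "('a::field^'n^'n) set \<Rightarrow> ('a^'n^'n) set" for S where
  span_zero: "0 \<in> span_mat S"
| span_base: "x \<in> S \<Longrightarrow> x \<in> span_mat S"
| span_add: "x \<in> span_mat S \<Longrightarrow> y \<in> span_mat S \<Longrightarrow> x + y \<in> span_mat S"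
| span_smult: "x \<in> span_mat S \<Longrightarrow> smat c x \<in> span_mat S"

definition bracket_space :: "('a::field^'n^'n) set \<Rightarrow> ('a^'n^'n) set \<Rightarrow> ('a^'n^'n) set" where
  "bracket_space A B = span_mat {lie_br x y | x y. x \<in> A \<and> y \<in> B}"

definition subspace_sl :: "('a::field^'n^'n) set \<Rightarrow> bool" where
  "subspace_sl H \<longleftrightarrow> H \<subseteq> sl \<and> 0 \<in> H \<and> (\<forall>x\<in>H. \<forall>y\<in>H. x + y \<in> H)
      \<and> (\<forall>c. \<forall>x\<in>H. smat c x \<in> H)"

definition subalgebra_sl :: "('a::field^'n^'n) set \<Rightarrow> bool" where
  "subalgebra_sl H \<longleftrightarrow> subspace_sl H \<and> (\<forall>x\<in>H. \<forall>y\<in>H. lie_br x y \<in> H)"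

fun lcs :: "('a::field^'n^'n) set \<Rightarrow> nat \<Rightarrow> ('a^'n^'n) set" where
  "lcs H 0 = H"
| "lcs H (Suc k) = bracket_space H (lcs H k)"

definition nilpotent_alg :: "('a::field^'n^'n) set \<Rightarrow> bool" where
  "nilpotent_alg H \<longleftrightarrow> (\<exists>k. lcs H k = {0})"

definition normalizer :: "('a::field^'n^'n) set \<Rightarrow> ('a^'n^'n) set" where
  "normalizer H = {x \<in> sl. \<forall>h\<in>H. lie_br x h \<in> H}"

definition cartan_sub :: "('a::field^'n^'n) set \<Rightarrow> bool" where
  "cartan_sub H \<longleftrightarrow> subalgebra_sl H \<and> nilpotent_alg H \<and> normalizer H = H"

definition abelian :: "('a::field^'n^'n) set \<Rightarrow> bool" where
  "abelian H \<longleftrightarrow> (\<forall>x\<in>H. \<forall>y\<in>H. lie_br x y = 0)"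

text \<open>Linear functionals on H, normalised to vanish outside H so that
  functionals are identified exactly when they agree on H.\<close>
definition lin_fun :: "('a::field^'n^'n) set \<Rightarrow> ('a^'n^'n \<Rightarrow> 'a) \<Rightarrow> bool" where
  "lin_fun H \<alpha> \<longleftrightarrow> (\<forall>x\<in>H. \<forall>y\<in>H. \<alpha> (x + y) = \<alpha> x + \<alpha> y)
      \<and> (\<forall>c. \<forall>x\<in>H. \<alpha> (smat c x) = c * \<alpha> x) \<and> (\<forall>x. x \<notin> H \<longrightarrow> \<alpha> x = 0)"

definition root_space :: "('a::field^'n^'n) set \<Rightarrow> ('a^'n^'n \<Rightarrow> 'a) \<Rightarrow> ('a^'n^'n) set" where
  "root_space H \<alpha> = {x \<in> sl. \<forall>h\<in>H. lie_br x h = smat (\<alpha> h) x}"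

definition is_root :: "('a::field^'n^'n) set \<Rightarrow> ('a^'n^'n \<Rightarrow> 'a) \<Rightarrow> bool" where
  "is_root H \<alpha> \<longleftrightarrow> lin_fun H \<alpha> \<and> root_space H \<alpha> \<noteq> {0}"

definition one_dim :: "('a::field^'n^'n) set \<Rightarrow> bool" where
  "one_dim V \<longleftrightarrow> (\<exists>v. v \<noteq> 0 \<and> V = {smat c v | c. True})"

definition classical_cartan :: "('a::field^'n^'n) set \<Rightarrow> bool" where
  "classical_cartan H \<longleftrightarrow> cartan_sub H \<and> abelian H
    \<comment> \<open>(a) root space decomposition, sum over roots, direct\<close>
    \<and> (\<forall>x\<in>sl. \<exists>R f. finite R \<and> (\<forall>\<alpha>\<in>R. is_root H \<alpha> \<and> f \<alpha> \<in> root_space H \<alpha>)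
            \<and> x = (\<Sum>\<alpha>\<in>R. f \<alpha>))
    \<and> (\<forall>R f. finite R \<longrightarrow> (\<forall>\<alpha>\<in>R. is_root H \<alpha> \<and> f \<alpha> \<in> root_space H \<alpha>)
            \<longrightarrow> (\<Sum>\<alpha>\<in>R. f \<alpha>) = 0 \<longrightarrow> (\<forall>\<alpha>\<in>R. f \<alpha> = 0))
    \<comment> \<open>(b)\<close>
    \<and> (\<forall>\<alpha>. is_root H \<alpha> \<and> \<alpha> \<noteq> (\<lambda>_. 0) \<longrightarrow>
          one_dim (bracket_space (root_space H \<alpha>) (root_space H (\<lambda>h. - \<alpha> h))))
    \<comment> \<open>(c)\<close>
    \<and> (\<forall>\<alpha> \<beta>. is_root H \<alpha> \<and> is_root H \<beta> \<and> \<beta> \<noteq> (\<lambda>_. 0) \<longrightarrow>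
          \<not> (\<forall>k\<in>{1..CHAR('a) - 1}. is_root H (\<lambda>h. \<alpha> h + of_nat k * \<beta> h)))"

definition killing :: "'a::field^'n^'n \<Rightarrow> 'a^'n^'n \<Rightarrow> 'a" where
  "killing A B = of_nat (2 * CARD('n)) * trace (A ** B)"

definition is_COD :: "(nat \<Rightarrow> ('a::field^'n^'n) set) \<Rightarrow> bool" where
  "is_COD H \<longleftrightarrow> (\<forall>i\<le>CARD('n). classical_cartan (H i))
    \<and> (\<forall>x\<in>sl. \<exists>f. (\<forall>i\<le>CARD('n). f i \<in> H i) \<and> x = (\<Sum>i\<le>CARD('n). f i))
    \<and> (\<forall>f. (\<forall>i\<le>CARD('n). f i \<in> H i) \<longrightarrow> (\<Sum>i\<le>CARD('n). f i) = 0
          \<longrightarrow> (\<forall>i\<le>CARD('n). f i = 0))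
    \<and> (\<forall>i\<le>CARD('n). \<forall>j\<le>CARD('n). i \<noteq> j \<longrightarrow>
          (\<forall>x\<in>H i. \<forall>y\<in>H j. killing x y = 0))"

definition lie_aut :: "('a::field^'n^'n \<Rightarrow> 'a^'n^'n) \<Rightarrow> bool" where
  "lie_aut \<phi> \<longleftrightarrow> bij_betw \<phi> sl sl
    \<and> (\<forall>x\<in>sl. \<forall>y\<in>sl. \<phi> (x + y) = \<phi> x + \<phi> y)
    \<and> (\<forall>c. \<forall>x\<in>sl. \<phi> (smat c x) = smat c (\<phi> x))
    \<and> (\<forall>x\<in>sl. \<forall>y\<in>sl. \<phi> (lie_br x y) = lie_br (\<phi> x) (\<phi> y))"

definition COD_conj :: "(nat \<Rightarrow> ('a::field^'n^'n) set) \<Rightarrow> (nat \<Rightarrow> ('a^'n^'n) set) \<Rightarrow> bool" where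
  "COD_conj H H' \<longleftrightarrow> (\<exists>\<phi>. lie_aut \<phi> \<and>
     (\<forall>i\<le>CARD('n). \<exists>!j. j \<le> CARD('n) \<and> \<phi> ` H i = H' j))"

definition primitive_root :: "nat \<Rightarrow> 'a::field \<Rightarrow> bool" where
  "primitive_root m z \<longleftrightarrow> z ^ m = 1 \<and> (\<forall>k. 0 < k \<and> k < m \<longrightarrow> z ^ k \<noteq> 1)"

end

theory Submission
  imports Defs
begin

text \<open>
  In the three-dimensional algebra of traceless 2 by 2 matrices with the trace form
  \<open>\<langle>x, y\<rangle> = Tr (x y)\<close>, everything follows from
  \<open>[[x, h], h] = 2 \<langle>h, h\<rangle> x - 2 \<langle>x, h\<rangle> h\<close>. It shows that the classical Cartan subalgebras
  occurring in a COD are exactly the lines spanned by some \<open>h\<close> with \<open>\<langle>h, h\<rangle> = 2\<close>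
  (a root value \<open>l \<noteq> 0\<close> on \<open>h\<close> satisfies \<open>l\<^sup>2 = 2 \<langle>h, h\<rangle>\<close>, so \<open>h\<close> can be rescaled inside
  the field). A COD is thus an orthogonal basis \<open>e0, e1, e2\<close> of vectors of square length 2. Then
  \<open>[e0, e1]\<close> is orthogonal to \<open>e0\<close> and \<open>e1\<close>, so it equals \<open>c e2\<close>, and the identity
  forces \<open>c\<^sup>2 = - 4\<close>: hence \<open>- 1 = (c / 2)\<^sup>2\<close> is a square. Conversely, replacing \<open>e2\<close> by \<open>- e2\<close>
  if necessary, \<open>c\<close> may be prescribed; the structure constants of two such bases then agree, so
  the linear map matching them is an automorphism.
\<close>

section \<open>Scalar multiplication, bracket and trace form\<close>

lemma smat_nth [simp]: "smat c A $ i $ j = c * A $ i $ j"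
  by (simp add: smat_def)

lemma mat_eq_iff: "A = B \<longleftrightarrow> (\<forall>i j. A $ i $ j = B $ i $ j)"
  by (simp add: vec_eq_iff)

lemma smat_0 [simp]: "smat 0 A = 0" "smat c 0 = 0"
  by (simp_all add: mat_eq_iff)

lemma smat_1 [simp]: "smat 1 A = A"
  by (simp add: mat_eq_iff)

lemma smat_smat [simp]: "smat a (smat b A) = smat (a * b) A"
  by (simp add: mat_eq_iff)

lemma smat_add_left: "smat (a + b) A = smat a A + smat b A"
  by (simp add: mat_eq_iff algebra_simps)

lemma smat_diff_left: "smat (a - b) A = smat a A - smat b A"
  by (simp add: mat_eq_iff algebra_simps)

lemma smat_add_right: "smat a (A + B) = smat a A + smat a B"
  by (simp add: mat_eq_iff algebra_simps)

lemma smat_diff_right: "smat a (A - B) = smat a A - smat a B"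
  by (simp add: mat_eq_iff algebra_simps)

lemma smat_minus: "smat (- a) A = - smat a A" "smat a (- A) = - smat a A"
  by (simp_all add: mat_eq_iff)

lemma smat_sum_right: "smat a (\<Sum>i\<in>I. f i) = (\<Sum>i\<in>I. smat a (f i))"
  by (simp add: mat_eq_iff sum_distrib_left)

lemma smat_eq_0_iff [simp]: "smat c A = 0 \<longleftrightarrow> c = 0 \<or> A = 0"
  by (auto simp: mat_eq_iff)

lemma smat_cancel: "c \<noteq> 0 \<Longrightarrow> smat c A = smat c B \<longleftrightarrow> A = B"
  by (simp add: mat_eq_iff)

lemma smat_mult [simp]: "smat c A ** B = smat c (A ** B)" "A ** smat c B = smat c (A ** B)"
  by (simp_all add: mat_eq_iff matrix_matrix_mult_def sum_distrib_left mult.left_commute mult.assoc)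

lemma matrix_mult_add:
  "(A + B) ** C = A ** C + B ** (C :: 'a::field^'n^'n)" "C ** (A + B) = C ** A + C ** B"
  by (simp_all add: mat_eq_iff matrix_matrix_mult_def sum.distrib algebra_simps)

lemma matrix_mult_minus: "(- A) ** B = - (A ** (B :: 'a::field^'n^'n))" "A ** (- B) = - (A ** B)"
  by (simp_all add: mat_eq_iff matrix_matrix_mult_def sum_negf)

lemma matrix_mult_diff:
  "(A - B) ** C = A ** C - B ** (C :: 'a::field^'n^'n)" "C ** (A - B) = C ** A - C ** B"
  by (simp_all add: mat_eq_iff matrix_matrix_mult_def sum_subtractf algebra_simps)

lemma trace_smat [simp]: "trace (smat c A) = c * trace A"
  by (simp add: trace_def sum_distrib_left)

lemma trace_minus: "trace (- A) = - trace (A :: 'a::field^'n^'n)"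
  by (simp add: trace_def sum_negf)

lemma lie_br_add: "lie_br (A + B) C = lie_br A C + lie_br B C" "lie_br C (A + B) = lie_br C A + lie_br C B"
  by (simp_all add: lie_br_def matrix_mult_add)

lemma lie_br_diff: "lie_br (A - B) C = lie_br A C - lie_br B C" "lie_br C (A - B) = lie_br C A - lie_br C B"
  by (simp_all add: lie_br_def matrix_mult_diff)

lemma lie_br_smat [simp]: "lie_br (smat c A) B = smat c (lie_br A B)" "lie_br A (smat c B) = smat c (lie_br A B)"
  by (simp_all add: lie_br_def smat_diff_right)

lemma lie_br_minus: "lie_br (- A) B = - lie_br A B" "lie_br A (- B) = - lie_br A B"
  by (simp_all add: lie_br_def matrix_mult_minus)

lemma lie_br_0 [simp]: "lie_br 0 A = 0" "lie_br A 0 = 0"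
  by (simp_all add: lie_br_def)

lemma lie_br_self [simp]: "lie_br A A = 0"
  by (simp add: lie_br_def)

lemma lie_br_swap: "lie_br A B = - lie_br B A"
  by (simp add: lie_br_def)

lemma lie_br_sum: "lie_br (\<Sum>i\<in>I. f i) A = (\<Sum>i\<in>I. lie_br (f i) A)"
  by (induction I rule: infinite_finite_induct) (simp_all add: lie_br_add)

lemma jacobi: "lie_br (lie_br x y) h = lie_br (lie_br x h) y + lie_br x (lie_br y h)"
  by (simp only: lie_br_def matrix_mult_diff matrix_mul_assoc) (simp only: algebra_simps)

text \<open>The Killing form without its scalar factor. For 2 by 2 matrices that factor is 4,
  invertible in characteristic > 3, so both forms give the same orthogonality.\<close>

definition trf :: "'a::field^'n^'n \<Rightarrow> 'a^'n^'n \<Rightarrow> 'a" where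
  "trf A B = trace (A ** B)"

lemma trf_add: "trf (A + B) C = trf A C + trf B C" "trf C (A + B) = trf C A + trf C B"
  by (simp_all add: trf_def matrix_mult_add trace_add)

lemma trf_diff: "trf (A - B) C = trf A C - trf B C" "trf C (A - B) = trf C A - trf C B"
  by (simp_all add: trf_def matrix_mult_diff trace_sub)

lemma trf_smat [simp]: "trf (smat c A) B = c * trf A B" "trf A (smat c B) = c * trf A B"
  by (simp_all add: trf_def)

lemma trf_minus [simp]: "trf (- A) B = - trf A B" "trf A (- B) = - trf A B"
  by (simp_all add: trf_def matrix_mult_minus trace_minus)

lemma trf_0 [simp]: "trf 0 A = 0" "trf A 0 = 0"
  by (simp_all add: trf_def trace_def)

lemma trf_commute: "trf A B = trf B A"
  unfolding trf_def by (rule trace_mul_sym)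

text \<open>Invariance of the trace form, from cyclicity of the trace.\<close>

lemma trf_lie_br: "trf (lie_br x y) z = trf x (lie_br y z)"
proof -
  have "trace (y ** x ** z) = trace (x ** z ** y)"
    by (metis matrix_mul_assoc trace_mul_sym)
  thus ?thesis
    by (simp add: trf_def lie_br_def matrix_mult_diff trace_sub matrix_mul_assoc)
qed

lemma trf_lie_br_self [simp]: "trf (lie_br x y) y = 0" "trf (lie_br x y) x = 0"
proof -
  show 1: "trf (lie_br x y) y = 0" for x y :: "'a^'n^'n" by (simp add: trf_lie_br)
  show "trf (lie_br x y) x = 0" using 1[of y x] by (simp add: lie_br_swap[of x y])
qed

lemma sl_add: "x \<in> sl \<Longrightarrow> y \<in> sl \<Longrightarrow> x + y \<in> sl"
  and sl_diff: "x \<in> sl \<Longrightarrow> y \<in> sl \<Longrightarrow> x - y \<in> sl"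
  and sl_smat: "x \<in> sl \<Longrightarrow> smat c x \<in> sl"
  and sl_0: "0 \<in> sl"
  and sl_minus: "x \<in> sl \<Longrightarrow> - x \<in> sl"
  by (simp_all add: sl_def trace_add trace_sub trace_minus) (simp add: trace_def)

lemma sl_lie_br: "lie_br x y \<in> sl"
  by (simp add: sl_def lie_br_def trace_sub trace_mul_sym[of x y])

lemmas sl_intros = sl_add sl_diff sl_smat sl_0 sl_minus sl_lie_br

section \<open>Lines, spans and independence of eigenvectors\<close>

definition line :: "'a::field^'n^'n \<Rightarrow> ('a^'n^'n) set" where
  "line h = {smat c h | c. True}"

lemma line_I: "smat c h \<in> line h"
  by (auto simp: line_def)

lemma line_E: "x \<in> line h \<Longrightarrow> (\<And>c. x = smat c h \<Longrightarrow> P) \<Longrightarrow> P"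
  by (auto simp: line_def)

lemma line_self: "h \<in> line h"
  using line_I[of 1 h] by simp

text \<open>Serves to recognise the bracket of two opposite root spaces as a line, as root condition
  (b) demands.\<close>

lemma span_mat_line:
  assumes "S \<subseteq> line h" "smat c h \<in> S" "c \<noteq> 0"
  shows "span_mat S = line h"
proof
  show "span_mat S \<subseteq> line h"
  proof
    fix x assume "x \<in> span_mat S"
    thus "x \<in> line h"
    proof induction
      case span_zero
      then show ?case using line_I[of 0 h] by simp
    next
      case (span_base x)
      then show ?case using assms(1) by auto
    next
      case (span_add x y)
      then show ?case by (metis line_E line_I smat_add_left)
    next
      case (span_smult x c)
      then show ?case by (metis line_E line_I smat_smat)
    qed
  qed
  show "line h \<subseteq> span_mat S"
  proof
    fix x assume "x \<in> line h"
    then obtain a where "x = smat a h" by (rule line_E)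
    hence "x = smat (a / c) (smat c h)" using assms(3) by simp
    thus "x \<in> span_mat S" using assms(2) span_mat.intros by blast
  qed
qed

lemma span_mat_0: "span_mat {0} = {0}"
proof -
  have "x = 0" if "x \<in> span_mat {0}" for x :: "'a^'n^'n"
    using that by induction simp_all
  thus ?thesis by (auto intro: span_mat.intros)
qed

text \<open>Applying \<open>[_, h] - l b\<close> to a relation kills the term at \<open>b\<close>
  and scales every other term by \<open>l c - l b\<close>, which is nonzero by injectivity;
  induction on \<open>R\<close> does the rest. This gives directness of the root space sum.\<close>

lemma eigenvectors_independent:
  assumes "finite R" "inj_on l R" "\<And>a. a \<in> R \<Longrightarrow> lie_br (f a) h = smat (l a) (f a)"
    and "(\<Sum>a\<in>R. f a) = 0" "a \<in> R"
  shows "f a = 0"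
  using assms
proof (induction R arbitrary: f a rule: finite_induct)
  case empty
  then show ?case by simp
next
  case (insert b R)
  have sum0: "f b + (\<Sum>c\<in>R. f c) = 0"
    using insert.prems insert.hyps by simp
  have "0 = lie_br (f b + (\<Sum>c\<in>R. f c)) h - smat (l b) (f b + (\<Sum>c\<in>R. f c))"
    using sum0 by simp
  also have "\<dots> = (\<Sum>c\<in>R. lie_br (f c) h - smat (l b) (f c))"
    using insert.prems(2)[of b] by (simp add: lie_br_add lie_br_sum smat_add_right smat_sum_right sum_subtractf)
  also have "\<dots> = (\<Sum>c\<in>R. smat (l c - l b) (f c))"
    using insert.prems(2) by (intro sum.cong) (auto simp: smat_diff_left)
  finally have s: "(\<Sum>c\<in>R. smat (l c - l b) (f c)) = 0" by simp
  have *: "f c = 0" if "c \<in> R" for c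
  proof -
    have "smat (l c - l b) (f c) = 0"
    proof (rule insert.IH[OF _ _ s that])
      show "inj_on l R" using insert.prems(1) by (auto simp: inj_on_def)
      show "lie_br (smat (l a - l b) (f a)) h = smat (l a) (smat (l a - l b) (f a))" if "a \<in> R" for a
        using insert.prems(2)[of a] that by (simp add: mult.commute)
    qed
    moreover have "l c \<noteq> l b"
      using insert.prems(1) insert.hyps(2) that by (auto simp: inj_on_def)
    ultimately show ?thesis by simp
  qed
  hence "f b = 0" using sum0 by simp
  with * show ?case using insert.prems by auto
qed

section \<open>The algebra of traceless 2 by 2 matrices\<close>

lemma sl2_nth: "x \<in> sl \<Longrightarrow> x $ 2 $ 2 = - (x $ 1 $ 1)" for x :: "'a::field^2^2"
  by (simp add: sl_def trace_def sum_2 add_eq_0_iff)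

text \<open>A polynomial identity in the entries, valid over every field; it is the counterpart of
  the triple product expansion for cross products.\<close>

lemma sl2_double_bracket:
  fixes x h :: "'a::field^2^2"
  assumes "x \<in> sl" "h \<in> sl"
  shows "lie_br (lie_br x h) h = smat (2 * trf h h) x - smat (2 * trf x h) h"
  using assms[THEN sl2_nth]
  by (simp add: mat_eq_iff forall_2 lie_br_def trf_def trace_def matrix_matrix_mult_def sum_2)
    (simp add: algebra_simps)

definition mk :: "'a::field \<Rightarrow> 'a \<Rightarrow> 'a \<Rightarrow> 'a^2^2" where
  "mk a b c = vector [vector [a, b], vector [c, - a]]"

lemma mk_nth [simp]: "mk a b c $ 1 $ 1 = a" "mk a b c $ 1 $ 2 = b" "mk a b c $ 2 $ 1 = c"
   "mk a b c $ 2 $ 2 = - a"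
  by (simp_all add: mk_def vector_2)

lemma mk_sl: "mk a b c \<in> sl"
  by (simp add: sl_def trace_def sum_2)

lemma trf_mk: "trf (mk a b c) (mk a' b' c') = 2 * a * a' + b * c' + c * b'"
  by (simp add: trf_def trace_def matrix_matrix_mult_def sum_2 algebra_simps)

text \<open>Bracketing with \<open>mk 1 0 0\<close> exposes the off-diagonal entries of
  \<open>h\<close>, and with \<open>mk 0 1 0\<close> the diagonal one, each up to a factor 2 or
  -2.\<close>

lemma sl2_central:
  fixes h :: "'a::field^2^2"
  assumes "(2::'a) \<noteq> 0" "h \<in> sl" "\<And>x. x \<in> sl \<Longrightarrow> lie_br x h = 0"
  shows "h = 0"
proof -
  have 1: "lie_br (mk 1 0 0) h = 0" and 2: "lie_br (mk 0 1 0) h = 0"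
    using assms mk_sl by blast+
  have "2 * h $ 1 $ 2 = 0" using arg_cong[OF 1, of "\<lambda>m. m $ 1 $ 2"]
    by (simp add: lie_br_def matrix_matrix_mult_def sum_2)
  moreover have "2 * h $ 2 $ 1 = 0" using arg_cong[OF 1, of "\<lambda>m. m $ 2 $ 1"]
    by (simp add: lie_br_def matrix_matrix_mult_def sum_2)
  moreover have "2 * h $ 1 $ 1 = 0" using arg_cong[OF 2, of "\<lambda>m. m $ 1 $ 2"] sl2_nth[OF assms(2)]
    by (simp add: lie_br_def matrix_matrix_mult_def sum_2)
  ultimately show ?thesis using assms(1) sl2_nth[OF assms(2)]
    by (simp add: mat_eq_iff forall_2)
qed

lemma small_numerals_nonzero:
  assumes "CHAR('a::field) > 3"
  shows "(2::'a) \<noteq> 0" "(3::'a) \<noteq> 0" "(4::'a) \<noteq> 0"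
proof -
  show 2: "(2::'a) \<noteq> 0" using assms of_nat_eq_0_iff_char_dvd[of 2, where 'a='a]
    by (auto dest: dvd_imp_le)
  show "(3::'a) \<noteq> 0" using assms of_nat_eq_0_iff_char_dvd[of 3, where 'a='a]
    by (auto dest: dvd_imp_le)
  have "(4::'a) = 2 * 2" by simp
  thus "(4::'a) \<noteq> 0" using 2 by (metis mult_eq_0_iff)
qed

section \<open>Classical Cartan subalgebras\<close>

text \<open>If \<open>[x, h] = 0\<close>, the double bracket identity reads
  \<open>0 = 4 x - 2 <x, h> h\<close>. So the centralizer of \<open>h\<close> is its line.\<close>

lemma sl2_commute_line:
  fixes x h :: "'a::field^2^2"
  assumes "(2::'a) \<noteq> 0" "x \<in> sl" "h \<in> sl" "trf h h = 2" "lie_br x h = 0"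
  shows "x = smat (trf x h / 2) h"
proof -
  have "smat 2 (smat 2 x) = smat 2 (smat 2 (smat (trf x h / 2) h))"
    using sl2_double_bracket[OF assms(2,3)] assms(1,4,5) by simp
  thus ?thesis using assms(1) by (simp only: smat_cancel not_False_eq_True)
qed

lemma eigenvector_orthogonal:
  assumes "lie_br y h = smat l y" "l \<noteq> 0"
  shows "trf y h = 0"
  using trf_lie_br_self(1)[of y h] assms by simp

text \<open>Since \<open>y\<close> is orthogonal to \<open>h\<close>, the identity leaves only
  \<open>2 <h, h> y\<close> for the double bracket, which is also \<open>l * l\<close> times
  \<open>y\<close>.\<close>

lemma sl2_eigenvalue:
  fixes y h :: "'a::field^2^2"
  assumes "y \<in> sl" "h \<in> sl" "y \<noteq> 0" "lie_br y h = smat l y" "l \<noteq> 0"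
  shows "l * l = 2 * trf h h"
proof -
  have "smat (l * l) y = smat (2 * trf h h) y"
    using sl2_double_bracket[OF assms(1,2)] eigenvector_orthogonal[OF assms(4,5)] assms(4) by simp
  hence "smat (l * l - 2 * trf h h) y = 0" by (simp add: smat_diff_left)
  with assms(3) show ?thesis by simp
qed

text \<open>Self-normalization yields some \<open>g \<noteq> 0\<close> in \<open>H\<close>, the root
  decomposition yields a nonzero root value at \<open>g\<close>, and commutativity confines
  \<open>H\<close> to the centralizer of the rescaled \<open>g\<close>.\<close>

lemma classical_cartan_imp_line:
  fixes H :: "('a::field^2^2) set"
  assumes two: "(2::'a) \<noteq> 0" and H: "classical_cartan H"
  shows "\<exists>h\<in>sl. trf h h = 2 \<and> H = line h"
proof -
  have sub: "subspace_sl H" and norm: "normalizer H = H" and ab: "abelian H"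
    using H by (auto simp: classical_cartan_def cartan_sub_def subalgebra_sl_def)
  have "\<exists>g\<in>H. g \<noteq> 0"
  proof (rule ccontr)
    assume "\<not> ?thesis"
    hence "H \<subseteq> {0}" by auto
    \<comment> \<open>Everything normalizes the zero algebra, so \<open>H\<close> would be all of
      \<open>sl\<close> and contain \<open>mk 1 0 0\<close>.\<close>
    hence "normalizer H = sl" using sub by (auto simp: normalizer_def subspace_sl_def)
    hence "mk (1::'a) 0 0 = 0" using norm \<open>H \<subseteq> {0}\<close> mk_sl[of "1::'a" 0 0] by blast
    hence "mk (1::'a) 0 0 $ 1 $ 1 = 0" by simp
    thus False by simp
  qed
  then obtain g where g: "g \<in> H" "g \<noteq> 0" by blast
  have gsl: "g \<in> sl" using g sub by (auto simp: subspace_sl_def)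
  obtain x where x: "x \<in> sl" "lie_br x g \<noteq> 0"
    using sl2_central[OF two gsl] g by blast
  have "\<forall>x\<in>sl. \<exists>R f. finite R \<and> (\<forall>\<alpha>\<in>R. is_root H \<alpha> \<and> f \<alpha> \<in> root_space H \<alpha>) \<and> x = (\<Sum>\<alpha>\<in>R. f \<alpha>)"
    using H unfolding classical_cartan_def by (elim conjE)
  from bspec[OF this x(1)] obtain R f where
    "finite R \<and> (\<forall>\<alpha>\<in>R. is_root H \<alpha> \<and> f \<alpha> \<in> root_space H \<alpha>) \<and> x = (\<Sum>\<alpha>\<in>R. f \<alpha>)"
    by (elim exE)
  hence R: "\<forall>\<alpha>\<in>R. is_root H \<alpha> \<and> f \<alpha> \<in> root_space H \<alpha>" "x = (\<Sum>\<alpha>\<in>R. f \<alpha>)"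
    by simp_all
  \<comment> \<open>As \<open>x\<close> does not commute with \<open>g\<close>, neither does one of
    its root components; its root is nonzero at \<open>g\<close>.\<close>
  obtain \<alpha> where \<alpha>: "\<alpha> \<in> R" "lie_br (f \<alpha>) g \<noteq> 0"
    using x(2) unfolding R(2) lie_br_sum by (meson sum.neutral)
  define l where "l = \<alpha> g"
  have y: "f \<alpha> \<in> sl" "lie_br (f \<alpha>) g = smat l (f \<alpha>)"
    using R(1) \<alpha>(1) g(1) by (auto simp: root_space_def l_def)
  have l: "l \<noteq> 0" "f \<alpha> \<noteq> 0" using \<alpha>(2) y(2) by auto
  have ll: "l * l = 2 * trf g g" using sl2_eigenvalue[OF y(1) gsl l(2) y(2) l(1)] .
  \<comment> \<open>The factor turns \<open><g, g>\<close> into \<open>4 <g, g> / (l * l)\<close>,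
    which is 2 because \<open>l * l = 2 <g, g>\<close>.\<close>
  define h where "h = smat (2 / l) g"
  have h: "h \<in> sl" "h \<in> H"
    using gsl g sub by (auto simp: h_def sl_smat subspace_sl_def)
  have "trf h h = 2 * (2 * trf g g) / (l * l)" by (simp add: h_def)
  also have "\<dots> = 2" unfolding ll[symmetric] using l(1) by simp
  finally have hh: "trf h h = 2" .
  have "H \<subseteq> line h"
  proof
    fix x assume "x \<in> H"
    hence "lie_br x h = 0" "x \<in> sl"
      using ab h sub by (auto simp: abelian_def subspace_sl_def)
    thus "x \<in> line h"
      using sl2_commute_line[OF two _ h(1) hh] line_I by metis
  qed
  moreover have "line h \<subseteq> H" using h sub by (auto simp: line_def subspace_sl_def)
  ultimately show ?thesis using h hh by blast
qed

text \<open>Off the line both functionals are 0 by the normalisation in \<open>lin_fun\<close>, so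
  roots can be compared by their values at \<open>h\<close> alone.\<close>

lemma lin_fun_line_eq:
  assumes "lin_fun (line h) \<alpha>" "lin_fun (line h) \<beta>" "\<alpha> h = \<beta> h"
  shows "\<alpha> = \<beta>"
proof
  fix x
  show "\<alpha> x = \<beta> x"
  proof (cases "x \<in> line h")
    case True
    then obtain c where "x = smat c h" by (rule line_E)
    thus ?thesis using assms line_self[of h] by (simp add: lin_fun_def)
  next
    case False
    thus ?thesis using assms by (simp add: lin_fun_def)
  qed
qed

lemma root_space_line:
  assumes "lin_fun (line h) \<alpha>"
  shows "root_space (line h) \<alpha> = {x \<in> sl. lie_br x h = smat (\<alpha> h) x}"
proof -
  have "\<alpha> (smat c h) = c * \<alpha> h" for c using assms line_self[of h] by (simp add: lin_fun_def)
  hence "(\<forall>g\<in>line h. lie_br x g = smat (\<alpha> g) x) \<longleftrightarrow> lie_br x h = smat (\<alpha> h) x" for x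
    using line_self[of h] by (auto simp: line_def)
  thus ?thesis by (simp add: root_space_def)
qed

text \<open>The auxiliary vector \<open>v\<close> provides the root vectors \<open>2 v \<plusminus> [v, h]\<close>.\<close>

lemma line_classical_cartan:
  fixes h v :: "'a::field^2^2"
  assumes char: "CHAR('a) > 3"
    and h: "h \<in> sl" "trf h h = 2" and v: "v \<in> sl" "trf v v = 2" and hv: "trf h v = 0"
  shows "classical_cartan (line h)"
proof -
  note nz = small_numerals_nonzero[OF char]
  let ?H = "line h"
  have h0: "h \<noteq> 0" using h(2) nz by auto
  have in_line: "x \<in> ?H" if "x \<in> sl" "lie_br x h = 0" for x
    using sl2_commute_line[OF nz(1) that(1) h that(2)] line_I by metis
  have H_sl: "?H \<subseteq> sl" using h sl_smat by (auto simp: line_def)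
  have ab: "lie_br x y = 0" if "x \<in> ?H" "y \<in> ?H" for x y
    using that by (auto simp: line_def)
  have sub: "subspace_sl ?H"
    unfolding subspace_sl_def using H_sl line_I[of 0 h]
    by (auto elim!: line_E simp flip: smat_add_left intro: line_I)
  have "lcs ?H 1 = {0}"
  proof -
    have "{lie_br x y |x y. x \<in> ?H \<and> y \<in> ?H} = {0}"
      using ab line_self[of h] by force
    thus ?thesis by (simp add: bracket_space_def span_mat_0)
  qed
  hence nil: "nilpotent_alg ?H" unfolding nilpotent_alg_def by blast
  have norm: "normalizer ?H = ?H"
  proof (intro equalityI subsetI)
    fix x assume x: "x \<in> normalizer ?H"
    then obtain c where c: "lie_br x h = smat c h"
      using line_self[of h] by (auto simp: normalizer_def elim: line_E)
    \<comment> \<open>By invariance \<open>[x, h] = c h\<close> is orthogonal to \<open>h\<close>,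
      while \<open><h, h> = 2\<close>.\<close>
    hence "c * 2 = 0" using trf_lie_br_self(1)[of x h] h(2) by simp
    hence "lie_br x h = 0" using c nz(1) by simp
    thus "x \<in> ?H" using x in_line by (auto simp: normalizer_def)
  next
    fix x assume x: "x \<in> ?H"
    show "x \<in> normalizer ?H"
      using x ab[OF x] H_sl sub by (auto simp: normalizer_def subspace_sl_def)
  qed
  have cartan: "cartan_sub ?H"
    using sub nil norm ab by (auto simp: cartan_sub_def subalgebra_sl_def subspace_sl_def)

  \<comment> \<open>The functional on the line with value \<open>l\<close> at \<open>h\<close>; the
    default 0 outside is what \<open>lin_fun\<close> requires.\<close>
  define rt where "rt l x = (if x \<in> ?H then l * (trf x h / 2) else 0)" for l :: 'a and x
  have rt_lin: "lin_fun ?H (rt l)" for l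
    using sub by (auto simp: lin_fun_def rt_def subspace_sl_def trf_add add_divide_distrib algebra_simps)
  have rt_h: "rt l h = l" for l using h(2) nz(1) line_self[of h] by (simp add: rt_def)
  \<comment> \<open>On vectors orthogonal to \<open>h\<close> the double bracket with
    \<open>h\<close> is multiplication by 4. Hence \<open>2 x + e [x, h]\<close> is an eigenvector
    for \<open>2 e\<close>, both signs being covered by \<open>e * e = 1\<close>.\<close>
  have eig: "smat 2 x + smat e (lie_br x h) \<in> root_space ?H (rt (2 * e))"
    if "x \<in> sl" "trf x h = 0" "e * e = 1" for x e
  proof -
    have "lie_br (smat 2 x + smat e (lie_br x h)) h = smat 2 (lie_br x h) + smat (e * 4) x"
      using sl2_double_bracket[OF that(1) h(1)] that(2) h(2) by (simp add: lie_br_add)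
    also have "\<dots> = smat (2 * e) (smat 2 x + smat e (lie_br x h))"
    proof -
      have "2 * e * e = 2" "2 * e * 2 = e * 4" using that(3) by (simp_all add: mult.assoc)
      thus ?thesis by (simp only: smat_add_right smat_smat add.commute)
    qed
    finally show ?thesis
      using that h by (simp add: root_space_line[OF rt_lin] rt_h sl_intros)
  qed
  define vp where "vp e = smat 2 v + smat e (lie_br v h)" for e
  have vp: "vp e \<in> root_space ?H (rt (2 * e))" if "e * e = 1" for e
    unfolding vp_def using eig[OF v(1) _ that] hv by (simp add: trf_commute)
  \<comment> \<open>The double bracket identity with \<open>h\<close> and \<open>v\<close>
    exchanged.\<close>
  have hvv: "lie_br v (lie_br v h) = smat 4 h"
  proof -
    have "lie_br v (lie_br v h) = - lie_br (lie_br v h) v" by (rule lie_br_swap)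
    also have "\<dots> = lie_br (lie_br h v) v"
      by (simp add: lie_br_swap[of v h] lie_br_minus)
    finally show ?thesis using sl2_double_bracket[OF h(1) v(1)] hv v(2) by simp
  qed
  \<comment> \<open>A nonzero multiple of \<open>h\<close> when \<open>e * e = 1\<close>. This shows
    that the root vectors do not vanish and later supplies the generator for condition (b).\<close>
  have vp_br: "lie_br (vp e) (vp (- e)) = smat (- 16 * e) h" for e
  proof -
    have "lie_br (lie_br v h) v = - smat 4 h" using hvv lie_br_swap by metis
    moreover have "lie_br (vp e) (vp (- e)) = smat (2 * e) (lie_br (lie_br v h) v - lie_br v (lie_br v h))"
      by (simp add: vp_def lie_br_add lie_br_diff smat_minus smat_diff_right mult.commute)
    ultimately have "lie_br (vp e) (vp (- e)) = smat (2 * e) (smat (- 4) h - smat 4 h)"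
      by (simp only: hvv smat_minus)
    thus ?thesis by (simp flip: smat_diff_left)
  qed
  have c16: "- 16 * e \<noteq> 0" if "e * e = 1" for e :: 'a
  proof -
    have "(16::'a) = 4 * 4" by simp
    hence "(16::'a) \<noteq> 0" using nz(3) by (simp only: mult_eq_0_iff) simp
    moreover have "e \<noteq> 0" using that by auto
    ultimately show ?thesis by (simp only: mult_eq_0_iff neg_equal_0_iff_equal) simp
  qed
  have vp0: "vp e \<noteq> 0" if "e * e = 1" for e
  proof
    assume "vp e = 0"
    hence "smat (- 16 * e) h = 0" using vp_br[of e] by (simp only: lie_br_0)
    thus False using h0 c16[OF that] by (simp only: smat_eq_0_iff) simp
  qed
  have rt_root: "is_root ?H (rt (2 * e))" if "e * e = 1" for e
    unfolding is_root_def using vp[OF that] vp0[OF that] rt_lin by auto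
  have h_zero: "smat c h \<in> root_space ?H (rt 0)" for c
    using h(1) by (simp add: root_space_line[OF rt_lin] rt_h sl_smat)
  have zero_root: "is_root ?H (rt 0)"
    unfolding is_root_def using h_zero[of 1] h0 rt_lin by auto
  \<comment> \<open>A nonzero root value squares to \<open>2 <h, h> = 4\<close>.\<close>
  have root_val: "\<alpha> h \<in> {0, 2, - 2}" if \<alpha>: "is_root ?H \<alpha>" for \<alpha>
  proof (cases "\<alpha> h = 0")
    case False
    have lf: "lin_fun ?H \<alpha>" using \<alpha> by (simp add: is_root_def)
    have "0 \<in> root_space ?H \<alpha>" by (simp add: root_space_line[OF lf] sl_0)
    then obtain y where y: "y \<in> root_space ?H \<alpha>" "y \<noteq> 0"
      using \<alpha> by (auto simp: is_root_def)
    hence "\<alpha> h * \<alpha> h = 2 * trf h h"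
      using sl2_eigenvalue[OF _ h(1) y(2) _ False] by (simp add: root_space_line[OF lf])
    hence "(\<alpha> h - 2) * (\<alpha> h + 2) = 0" by (simp add: h(2) algebra_simps)
    hence "\<alpha> h = 2 \<or> \<alpha> h + 2 = 0" by simp
    thus ?thesis by (auto simp only: insert_iff eq_neg_iff_add_eq_0)
  qed simp
  have root_eq: "\<alpha> = \<beta>" if "is_root ?H \<alpha>" "is_root ?H \<beta>" "\<alpha> h = \<beta> h" for \<alpha> \<beta>
    using that lin_fun_line_eq by (auto simp: is_root_def)

  have a1: "\<exists>R f. finite R \<and> (\<forall>\<alpha>\<in>R. is_root ?H \<alpha> \<and> f \<alpha> \<in> root_space ?H \<alpha>) \<and> x = (\<Sum>\<alpha>\<in>R. f \<alpha>)"
    if x: "x \<in> sl" for x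
  proof -
    \<comment> \<open>\<open>t h\<close> is the component of \<open>x\<close> along
      \<open>h\<close>. The remainder \<open>u\<close> is orthogonal to \<open>h\<close> and is the
      sum of \<open>(2 u + [u, h]) / 4\<close> and \<open>(2 u - [u, h]) / 4\<close>, one for each
      sign.\<close>
    define t where "t = trf x h / 2"
    define u where "u = x - smat t h"
    have u: "u \<in> sl" "trf u h = 0"
      using x h nz by (simp_all add: u_def sl_intros trf_diff t_def)
    define up where "up e = smat (1 / 4) (smat 2 u + smat e (lie_br u h))" for e
    have up: "up e \<in> root_space ?H (rt (2 * e))" if "e * e = 1" for e
      using eig[OF u that] by (simp add: up_def root_space_line[OF rt_lin] sl_smat rt_h mult.commute)
    define f where "f \<alpha> = (if \<alpha> h = 0 then smat t h else if \<alpha> h = 2 then up 1 else up (- 1))"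
      for \<alpha> :: "'a^2^2 \<Rightarrow> 'a"
    have ne: "(2::'a) \<noteq> - 2" using nz(3) by (simp add: eq_neg_iff_add_eq_0)
    have "rt 0 \<noteq> rt 2" "rt 0 \<noteq> rt (- 2)" "rt 2 \<noteq> rt (- 2)"
      using nz(1) ne rt_h[of 0] rt_h[of 2] rt_h[of "- 2"] by auto
    hence "(\<Sum>\<alpha>\<in>{rt 0, rt 2, rt (- 2)}. f \<alpha>) = smat t h + (up 1 + up (- 1))"
      using nz ne by (simp add: f_def rt_h)
    also have "\<dots> = x"
    proof -
      have "smat 2 u + lie_br u h + (smat 2 u - lie_br u h) = smat 4 u"
        by (simp add: mat_eq_iff)
      hence "up 1 + up (- 1) = smat (1 / 4) (smat 4 u)"
        by (simp add: up_def smat_minus flip: smat_add_right)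
      thus ?thesis using nz(3) by (simp add: u_def)
    qed
    finally have "x = (\<Sum>\<alpha>\<in>{rt 0, rt 2, rt (- 2)}. f \<alpha>)" by (rule sym)
    moreover have "\<forall>\<alpha>\<in>{rt 0, rt 2, rt (- 2)}. is_root ?H \<alpha> \<and> f \<alpha> \<in> root_space ?H \<alpha>"
      using rt_root[of 1] rt_root[of "- 1"] zero_root up[of 1] up[of "- 1"] h_zero[of t] nz(1) ne
      by (auto simp: f_def rt_h)
    ultimately show ?thesis
      by (intro exI[of _ "{rt 0, rt 2, rt (- 2)}"] exI[of _ f] conjI) simp_all
  qed

  have a2: "f \<alpha> = 0" if "finite R" and fR: "\<forall>\<alpha>\<in>R. is_root ?H \<alpha> \<and> f \<alpha> \<in> root_space ?H \<alpha>"
    and "(\<Sum>\<alpha>\<in>R. f \<alpha>) = 0" "\<alpha> \<in> R" for R f \<alpha>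
  proof (rule eigenvectors_independent[OF that(1) _ _ that(3,4)])
    \<comment> \<open>Distinct roots differ already at \<open>h\<close>, so the values at
      \<open>h\<close> serve as distinct eigenvalues.\<close>
    show "inj_on (\<lambda>\<alpha>. \<alpha> h) R" using bspec[OF fR] root_eq by (blast intro: inj_onI)
    show "lie_br (f a) h = smat (a h) (f a)" if "a \<in> R" for a
      using bspec[OF fR that] line_self[of h] by (auto simp: root_space_def)
  qed

  have b: "one_dim (bracket_space (root_space ?H \<alpha>) (root_space ?H (\<lambda>h. - \<alpha> h)))"
    if \<alpha>: "is_root ?H \<alpha>" "\<alpha> \<noteq> (\<lambda>_. 0)" for \<alpha>
  proof -
    have rt0: "rt 0 = (\<lambda>_. 0)" by (auto simp: rt_def)
    have "\<alpha> h \<noteq> 0" using root_eq[OF \<alpha>(1) zero_root] \<alpha>(2) rt0 rt_h[of 0] by auto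
    with root_val[OF \<alpha>(1)] obtain e where e: "e * e = 1" "\<alpha> h = 2 * e"
      using that[of 1] that[of "- 1"] by auto
    have \<alpha>_eq: "\<alpha> = rt (2 * e)" using root_eq[OF \<alpha>(1) rt_root[OF e(1)]] e(2) rt_h by simp
    have m\<alpha>: "(\<lambda>h. - \<alpha> h) = rt (2 * - e)" by (auto simp: \<alpha>_eq rt_def)
    let ?S = "{lie_br x y |x y. x \<in> root_space ?H (rt (2 * e)) \<and> y \<in> root_space ?H (rt (2 * - e))}"
    have "?S \<subseteq> line h"
    proof clarify
      fix x y assume "x \<in> root_space ?H (rt (2 * e))" "y \<in> root_space ?H (rt (2 * - e))"
      hence "lie_br x h = smat (2 * e) x" "lie_br y h = smat (2 * - e) y"
        by (simp_all add: root_space_line[OF rt_lin] rt_h)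
      \<comment> \<open>By the Jacobi identity the eigenvalues \<open>2 e\<close> and
        \<open>- 2 e\<close> add up to 0; the bracket then lies in the centralizer of
        \<open>h\<close>.\<close>
      hence "lie_br (lie_br x y) h = 0"
        by (simp add: jacobi[of x y h] smat_minus lie_br_minus)
      thus "lie_br x y \<in> line h" using in_line sl_lie_br by blast
    qed
    moreover have "lie_br (vp e) (vp (- e)) \<in> ?S"
      using vp[of e] vp[of "- e"] e(1) by auto
    hence "smat (- 16 * e) h \<in> ?S" by (simp only: vp_br)
    moreover note c16[OF e(1)]
    ultimately have "bracket_space (root_space ?H \<alpha>) (root_space ?H (\<lambda>h. - \<alpha> h)) = line h"
      unfolding bracket_space_def m\<alpha> unfolding \<alpha>_eq by (rule span_mat_line)
    thus ?thesis unfolding one_dim_def line_def using h0 by blast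
  qed

  have c: "\<not> (\<forall>k\<in>{1..CHAR('a) - 1}. is_root ?H (\<lambda>h. \<alpha> h + of_nat k * \<beta> h))"
    if \<beta>: "is_root ?H \<beta>" "\<beta> \<noteq> (\<lambda>_. 0)" for \<alpha> \<beta>
  proof
    assume all: "\<forall>k\<in>{1..CHAR('a) - 1}. is_root ?H (\<lambda>h. \<alpha> h + of_nat k * \<beta> h)"
    have rt0: "rt 0 = (\<lambda>_. 0)" by (auto simp: rt_def)
    have b0: "\<beta> h \<noteq> 0" using root_eq[OF \<beta>(1) zero_root] \<beta>(2) rt0 rt_h[of 0] by auto
    \<comment> \<open>A full string would give \<open>CHAR('a) - 1\<close> distinct values within a
      set of at most three elements, so the characteristic would be at most 4. The value 4 is
      excluded since \<open>4 \<noteq> 0\<close> in the field.\<close>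
    let ?f = "\<lambda>k. \<alpha> h + of_nat k * \<beta> h"
    have "?f ` {1..CHAR('a) - 1} \<subseteq> {0, 2, - 2}"
      using root_val[OF bspec[OF all]] by (intro image_subsetI)
    hence "card (?f ` {1..CHAR('a) - 1}) \<le> card {0, 2, - 2 :: 'a}"
      by (intro card_mono) auto
    also have "\<dots> \<le> 3" by (simp add: card_insert_if)
    finally have "card (?f ` {1..CHAR('a) - 1}) \<le> 3" .
    moreover have "inj_on ?f {1..CHAR('a) - 1}"
    proof (rule linorder_inj_onI')
      fix i j assume ij: "i \<in> {1..CHAR('a) - 1}" "j \<in> {1..CHAR('a) - 1}" "i < j"
      hence "\<not> CHAR('a) dvd j - i" by (auto dest: dvd_imp_le)
      hence "(of_nat (j - i) :: 'a) \<noteq> 0" by (simp add: of_nat_eq_0_iff_char_dvd)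
      thus "?f i \<noteq> ?f j" using ij(3) b0 by (simp add: of_nat_diff)
    qed
    ultimately have "CHAR('a) - 1 \<le> 3" by (simp add: card_image)
    moreover have "CHAR('a) \<noteq> 4"
    proof
      assume "CHAR('a) = 4"
      hence "(of_nat 4 :: 'a) = 0" by (metis of_nat_CHAR)
      thus False using nz(3) by simp
    qed
    ultimately show False using char by simp
  qed
  show ?thesis
    unfolding classical_cartan_def
  proof (intro conjI)
    show "cartan_sub ?H" by (rule cartan)
    show "abelian ?H" unfolding abelian_def by (intro ballI) (rule ab)
    show "\<forall>x\<in>sl. \<exists>R f. finite R \<and> (\<forall>\<alpha>\<in>R. is_root ?H \<alpha> \<and> f \<alpha> \<in> root_space ?H \<alpha>)
        \<and> x = (\<Sum>\<alpha>\<in>R. f \<alpha>)"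
      by (intro ballI) (rule a1)
    show "\<forall>R f. finite R \<longrightarrow> (\<forall>\<alpha>\<in>R. is_root ?H \<alpha> \<and> f \<alpha> \<in> root_space ?H \<alpha>)
        \<longrightarrow> (\<Sum>\<alpha>\<in>R. f \<alpha>) = 0 \<longrightarrow> (\<forall>\<alpha>\<in>R. f \<alpha> = 0)"
      by (intro allI impI ballI) (rule a2)
    show "\<forall>\<alpha>. is_root ?H \<alpha> \<and> \<alpha> \<noteq> (\<lambda>_. 0) \<longrightarrow>
        one_dim (bracket_space (root_space ?H \<alpha>) (root_space ?H (\<lambda>h. - \<alpha> h)))"
      by (intro allI impI) (elim conjE, rule b)
    show "\<forall>\<alpha> \<beta>. is_root ?H \<alpha> \<and> is_root ?H \<beta> \<and> \<beta> \<noteq> (\<lambda>_. 0) \<longrightarrow>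
        \<not> (\<forall>k\<in>{1..CHAR('a) - 1}. is_root ?H (\<lambda>h. \<alpha> h + of_nat k * \<beta> h))"
      by (intro allI impI) (elim conjE, rule c)
  qed
qed

section \<open>Orthogonal decompositions\<close>

lemma atMost_2: "{..2::nat} = {0, 1, 2}"
  by auto

lemma sum_atMost_2: "(\<Sum>i\<le>2::nat. f i) = f 0 + f 1 + f 2"
  by (simp add: atMost_2 add.assoc)

text \<open>The constant \<open>c\<close> is a square root of \<open>- 4\<close>; its sign is the orientation of the basis.\<close>

definition sl2_basis :: "'a::field \<Rightarrow> (nat \<Rightarrow> 'a^2^2) \<Rightarrow> bool" where
  "sl2_basis c e \<longleftrightarrow> (\<forall>i\<le>2. e i \<in> sl \<and> trf (e i) (e i) = 2)
     \<and> (\<forall>i\<le>2. \<forall>j\<le>2. i \<noteq> j \<longrightarrow> trf (e i) (e j) = 0)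
     \<and> (\<forall>x\<in>sl. x = (\<Sum>i\<le>2. smat (trf x (e i) / 2) (e i)))
     \<and> lie_br (e 0) (e 1) = smat c (e 2)"

lemma sl2_basisD:
  assumes "sl2_basis c e"
  shows "i \<le> 2 \<Longrightarrow> e i \<in> sl" "i \<le> 2 \<Longrightarrow> trf (e i) (e i) = 2"
    "i \<le> 2 \<Longrightarrow> j \<le> 2 \<Longrightarrow> i \<noteq> j \<Longrightarrow> trf (e i) (e j) = 0"
    "x \<in> sl \<Longrightarrow> x = (\<Sum>i\<le>2. smat (trf x (e i) / 2) (e i))"
    "lie_br (e 0) (e 1) = smat c (e 2)"
  using assms unfolding sl2_basis_def by blast+

text \<open>The identity gives \<open>[[e 0, e 1], e 1] = 4 e 0\<close>. Pairing with
  \<open>e 0\<close> and moving the bracket by invariance yields \<open>8 = - 2 c * c\<close>; the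
  other two brackets follow by cancelling \<open>c\<close>.\<close>

lemma sl2_basis_brackets:
  assumes four: "(4::'a::field) \<noteq> 0" and e: "sl2_basis c (e :: nat \<Rightarrow> 'a^2^2)"
  shows "c * c = - 4" "lie_br (e 1) (e 2) = smat c (e 0)" "lie_br (e 2) (e 0) = smat c (e 1)"
proof -
  have sl: "e 0 \<in> sl" "e 1 \<in> sl" "e 2 \<in> sl" using sl2_basisD(1)[OF e] by auto
  have n: "trf (e 0) (e 0) = 2" "trf (e 1) (e 1) = 2" "trf (e 2) (e 2) = 2"
    using sl2_basisD(2)[OF e] by auto
  have o: "trf (e 0) (e 1) = 0" "trf (e 1) (e 0) = 0"
    using sl2_basisD(3)[OF e] by auto
  note br = sl2_basisD(5)[OF e]
  have b1: "smat c (lie_br (e 2) (e 1)) = smat 4 (e 0)"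
    using sl2_double_bracket[OF sl(1,2)] n o br by simp
  have "lie_br (lie_br (e 1) (e 0)) (e 0) = smat 4 (e 1)"
    using sl2_double_bracket[OF sl(2,1)] n o by simp
  hence b0: "smat c (lie_br (e 2) (e 0)) = smat (- 4) (e 1)"
    using br by (simp add: lie_br_swap[of "e 1" "e 0"] lie_br_minus smat_minus minus_equation_iff del: One_nat_def)
  have "trf (lie_br (smat c (e 2)) (e 1)) (e 0) = trf (smat c (e 2)) (lie_br (e 1) (e 0))"
    by (rule trf_lie_br)
  also have "\<dots> = - (c * c * 2)"
    using br n by (simp add: lie_br_swap[of "e 1" "e 0"] del: One_nat_def)
  finally have "trf (smat 4 (e 0)) (e 0) = - (c * c * 2)"
    using b1 by (simp only: lie_br_smat)
  hence "4 * 2 = - (c * c * 2)" using n by simp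
  hence "4 * 2 + c * c * 2 = 0" by (simp only: eq_neg_iff_add_eq_0)
  hence "2 * (c * c + 4) = 0" by (simp add: algebra_simps)
  moreover have "(2::'a) \<noteq> 0" using four by (metis mult_zero_left mult_2 numeral_Bit0 add_0)
  ultimately have "c * c + 4 = 0" by (metis mult_eq_0_iff)
  thus cc: "c * c = - 4" by (simp add: eq_neg_iff_add_eq_0)
  hence c0: "c \<noteq> 0" using four by auto
  have "smat c (lie_br (e 2) (e 0)) = smat c (smat c (e 1))"
    using b0 cc by simp
  thus "lie_br (e 2) (e 0) = smat c (e 1)" by (simp only: smat_cancel[OF c0])
  have "smat c (lie_br (e 1) (e 2)) = smat c (smat c (e 0))"
    using b1 cc by (simp add: lie_br_swap[of "e 1" "e 2"] smat_minus del: One_nat_def)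
  thus "lie_br (e 1) (e 2) = smat c (e 0)" by (simp only: smat_cancel[OF c0])
qed

lemma killing_eq: "killing x y = 4 * trf x y" for x y :: "'a::field^2^2"
  by (simp add: killing_def trf_def)

text \<open>Each component is a line with a generator of square length 2, the generators are
  orthogonal, and pairing with them recovers the coordinates of any \<open>x\<close>.\<close>

lemma COD_basis:
  fixes H :: "nat \<Rightarrow> ('a::field^2^2) set"
  assumes char: "CHAR('a) > 3" and H: "is_COD H"
  shows "\<exists>c e. sl2_basis c e \<and> (\<forall>i\<le>2. H i = line (e i))"
proof -
  note nz = small_numerals_nonzero[OF char]
  have "\<forall>i\<le>2. classical_cartan (H i)" using H unfolding is_COD_def by simp
  hence "\<forall>i. \<exists>h. i \<le> 2 \<longrightarrow> h \<in> sl \<and> trf h h = 2 \<and> H i = line h"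
    using classical_cartan_imp_line[OF nz(1)] by blast
  then obtain e where e: "\<And>i. i \<le> 2 \<Longrightarrow> e i \<in> sl \<and> trf (e i) (e i) = 2 \<and> H i = line (e i)"
    by metis
  have o: "trf (e i) (e j) = 0" if "i \<le> 2" "j \<le> 2" "i \<noteq> j" for i j
  proof -
    have "\<forall>i\<le>2. \<forall>j\<le>2. i \<noteq> j \<longrightarrow> (\<forall>x\<in>H i. \<forall>y\<in>H j. killing x y = 0)"
      using H unfolding is_COD_def by simp
    moreover have "e i \<in> H i" "e j \<in> H j" using e that line_self by auto
    ultimately have "killing (e i) (e j) = 0" using that by blast
    thus ?thesis using nz(3) by (simp add: killing_eq)
  qed
  have span: "x = (\<Sum>i\<le>2. smat (trf x (e i) / 2) (e i))" if x: "x \<in> sl" for x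
  proof -
    have "\<forall>x\<in>sl. \<exists>f. (\<forall>i\<le>2. f i \<in> H i) \<and> x = (\<Sum>i\<le>2. f i)"
      using H unfolding is_COD_def by simp
    from bspec[OF this x] obtain f where f: "\<forall>i\<le>2. f i \<in> H i" and xf: "x = (\<Sum>i\<le>2. f i)"
      by (elim exE conjE)
    have "\<forall>i. \<exists>a. i \<le> 2 \<longrightarrow> f i = smat a (e i)"
      using f e by (metis line_E)
    then obtain a where a: "\<And>i. i \<le> 2 \<Longrightarrow> f i = smat (a i) (e i)" by metis
    have x_eq: "x = smat (a 0) (e 0) + smat (a 1) (e 1) + smat (a 2) (e 2)"
      using xf a by (simp add: sum_atMost_2)
    have "trf x (e 0) = a 0 * 2" "trf x (e 1) = a 1 * 2" "trf x (e 2) = a 2 * 2"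
      using o e by (simp_all add: x_eq trf_add)
    thus ?thesis using nz(1) by (simp add: sum_atMost_2 del: One_nat_def) (rule x_eq)
  qed
  \<comment> \<open>The bracket is orthogonal to both its arguments, so only the coordinate at
    \<open>e 2\<close> survives.\<close>
  have "lie_br (e 0) (e 1) = smat (trf (lie_br (e 0) (e 1)) (e 2) / 2) (e 2)"
    using span[OF sl_lie_br, of "e 0" "e 1"] by (simp add: sum_atMost_2)
  hence "sl2_basis (trf (lie_br (e 0) (e 1)) (e 2) / 2) e"
    unfolding sl2_basis_def using e o span by blast
  thus ?thesis using e by blast
qed

text \<open>The constant of any adapted basis also squares to -4, hence is \<open>c\<close> or
  \<open>- c\<close>. Negating \<open>e 2\<close> flips its sign and keeps all three lines.\<close>

lemma COD_basis_fixed_constant: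
  fixes H :: "nat \<Rightarrow> ('a::field^2^2) set"
  assumes char: "CHAR('a) > 3" and H: "is_COD H" and c: "c * c = - 4"
  shows "\<exists>e. sl2_basis c e \<and> (\<forall>i\<le>2. H i = line (e i))"
proof -
  obtain b e where e: "sl2_basis b e" and He: "\<forall>i\<le>2. H i = line (e i)"
    using COD_basis[OF char H] by blast
  have "b * b = c * c"
    using sl2_basis_brackets(1)[OF small_numerals_nonzero(3)[OF char] e] c by simp
  hence "b = c \<or> b = - c" by (simp add: square_eq_iff)
  thus ?thesis
  proof
    assume "b = - c"
    define g where "g = e(2 := - e 2)"
    have "sl2_basis c g"
      using e \<open>b = - c\<close> unfolding sl2_basis_def g_def
      by (simp add: sl_minus smat_minus sum_atMost_2)
    moreover have "line (- x) = line x" for x :: "'a^2^2"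
      unfolding line_def by (metis minus_minus smat_minus)
    ultimately show ?thesis using He by (intro exI[of _ g]) (simp add: g_def)
  qed (use e He in blast)
qed

section \<open>The automorphism matching two bases\<close>

text \<open>On an orthogonal basis \<open>e\<close> of square lengths 2 this is the linear map
  taking each \<open>e i\<close> to \<open>g i\<close>: the pairings divided by 2 are the
  coordinates.\<close>

definition transfer :: "(nat \<Rightarrow> 'a::field^2^2) \<Rightarrow> (nat \<Rightarrow> 'a^2^2) \<Rightarrow> 'a^2^2 \<Rightarrow> 'a^2^2" where
  "transfer e g x = (\<Sum>i\<le>2. smat (trf x (e i) / 2) (g i))"

lemma transfer_add: "transfer e g (x + y) = transfer e g x + transfer e g y"
  by (simp add: transfer_def sum_atMost_2 trf_add add_divide_distrib smat_add_left)

lemma transfer_smat: "transfer e g (smat c x) = smat c (transfer e g x)"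
  by (simp add: transfer_def smat_sum_right)

lemma transfer_basis:
  assumes "(2::'a::field) \<noteq> 0" "sl2_basis c (e :: nat \<Rightarrow> 'a^2^2)" "i \<le> 2"
  shows "transfer e g (e i) = g i"
proof -
  have "i = 0 \<or> i = 1 \<or> i = 2" using assms(3) by auto
  thus ?thesis
    using sl2_basisD(2)[OF assms(2)] sl2_basisD(3)[OF assms(2)] assms(1)
    by (auto simp: transfer_def sum_atMost_2)
qed

lemma transfer_sl: "sl2_basis c g \<Longrightarrow> transfer e g x \<in> sl"
  by (simp add: transfer_def sum_atMost_2 sl_intros sl2_basisD(1))

lemma transfer_inverse:
  assumes "(2::'a::field) \<noteq> 0" "sl2_basis c (e :: nat \<Rightarrow> 'a^2^2)" "sl2_basis d g" "x \<in> sl"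
  shows "transfer g e (transfer e g x) = x"
proof -
  have "transfer g e (transfer e g x) = (\<Sum>i\<le>2. smat (trf x (e i) / 2) (e i))"
    unfolding transfer_def[of e g]
    using transfer_basis[OF assms(1,3), of _ e]
    by (simp add: sum_atMost_2 transfer_add transfer_smat)
  also have "\<dots> = x" using sl2_basisD(4)[OF assms(2,4)] by (rule sym)
  finally show ?thesis .
qed

text \<open>In coordinates the bracket is \<open>c\<close> times the cross product, so
  \<open>c\<close> alone fixes the structure constants.\<close>

lemma sl2_basis_bracket_coordinates:
  assumes "(4::'a::field) \<noteq> 0" "sl2_basis c (e :: nat \<Rightarrow> 'a^2^2)"
  shows "lie_br (smat a0 (e 0) + smat a1 (e 1) + smat a2 (e 2))
           (smat b0 (e 0) + smat b1 (e 1) + smat b2 (e 2))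
     = smat (c * (a1 * b2 - a2 * b1)) (e 0) + smat (c * (a2 * b0 - a0 * b2)) (e 1)
         + smat (c * (a0 * b1 - a1 * b0)) (e 2)"
proof -
  note br = sl2_basis_brackets(2,3)[OF assms] sl2_basisD(5)[OF assms(2)]
  have "lie_br (e 1) (e 0) = - smat c (e 2)" "lie_br (e 2) (e 1) = - smat c (e 0)"
    "lie_br (e 0) (e 2) = - smat c (e 1)"
    using br by (metis lie_br_swap)+
  thus ?thesis using br
    by (simp add: lie_br_add smat_minus) (simp add: mat_eq_iff algebra_simps)
qed

text \<open>Both bases have the same constant \<open>c\<close>, so the bracket has the same
  coordinate formula in each.\<close>

lemma transfer_lie_br:
  assumes four: "(4::'a::field) \<noteq> 0" "(2::'a) \<noteq> 0"
    and e: "sl2_basis c (e :: nat \<Rightarrow> 'a^2^2)" and g: "sl2_basis c g"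
    and x: "x \<in> sl" and y: "y \<in> sl"
  shows "transfer e g (lie_br x y) = lie_br (transfer e g x) (transfer e g y)"
proof -
  define a b where "a i = trf x (e i) / 2" and "b i = trf y (e i) / 2" for i
  have T: "transfer e g (smat r (e 0) + smat s (e 1) + smat t (e 2))
      = smat r (g 0) + smat s (g 1) + smat t (g 2)" for r s t
    using transfer_basis[OF four(2) e, of _ g] by (simp add: transfer_add transfer_smat)
  have x_eq: "x = smat (a 0) (e 0) + smat (a 1) (e 1) + smat (a 2) (e 2)"
    using sl2_basisD(4)[OF e x] unfolding sum_atMost_2 a_def .
  have y_eq: "y = smat (b 0) (e 0) + smat (b 1) (e 1) + smat (b 2) (e 2)"
    using sl2_basisD(4)[OF e y] unfolding sum_atMost_2 b_def .
  show ?thesis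
    unfolding x_eq y_eq sl2_basis_bracket_coordinates[OF four(1) e] T
    by (rule sl2_basis_bracket_coordinates[OF four(1) g, symmetric])
qed

lemma COD_conj_if_sqrt:
  fixes H H' :: "nat \<Rightarrow> ('a::field^2^2) set"
  assumes char: "CHAR('a) > 3" and H: "is_COD H" "is_COD H'" and c: "c * c = - (4::'a)"
  shows "COD_conj H H'"
proof -
  note nz = small_numerals_nonzero[OF char]
  obtain e where e: "sl2_basis c e" and He: "\<And>i. i \<le> 2 \<Longrightarrow> H i = line (e i)"
    using COD_basis_fixed_constant[OF char H(1) c] by blast
  obtain g where g: "sl2_basis c g" and Hg: "\<And>i. i \<le> 2 \<Longrightarrow> H' i = line (g i)"
    using COD_basis_fixed_constant[OF char H(2) c] by blast
  let ?\<phi> = "transfer e g"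
  have "bij_betw ?\<phi> sl sl"
    by (rule bij_betw_byWitness[where f' = "transfer g e"])
      (auto simp: transfer_inverse[OF nz(1) e g] transfer_inverse[OF nz(1) g e]
        transfer_sl[OF e] transfer_sl[OF g])
  hence "lie_aut ?\<phi>"
    unfolding lie_aut_def
    using transfer_lie_br[OF nz(3,1) e g] by (simp add: transfer_add transfer_smat)
  moreover have "\<exists>!j. j \<le> 2 \<and> ?\<phi> ` H i = H' j" if i: "i \<le> 2" for i
  proof -
    have "?\<phi> ` H i = {?\<phi> (smat a (e i)) | a. True}"
      using He[OF i] by (auto simp: line_def)
    also have "\<dots> = H' i"
      using Hg[OF i] transfer_basis[OF nz(1) e i] by (simp add: line_def transfer_smat)
    finally have im: "?\<phi> ` H i = H' i" .
    \<comment> \<open>Uniqueness of the matching component: if two lines coincided,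
      \<open>g j\<close> would be a multiple of a vector orthogonal to it, against
      \<open><g j, g j> = 2\<close>.\<close>
    moreover have "j = i" if j: "j \<le> 2" and eq: "H' i = H' j" for j
    proof (rule ccontr)
      assume "j \<noteq> i"
      have "g j \<in> line (g i)" using eq Hg[OF i] Hg[OF j] line_self by auto
      then obtain a where "g j = smat a (g i)" by (rule line_E)
      hence "trf (g j) (g j) = 0" using sl2_basisD(3)[OF g i j] \<open>j \<noteq> i\<close> by simp
      thus False using sl2_basisD(2)[OF g j] nz(1) by simp
    qed
    ultimately show ?thesis using i by metis
  qed
  ultimately show ?thesis unfolding COD_conj_def by auto
qed

section \<open>Existence, and the link with fourth roots of unity\<close>

text \<open>The three lines are spanned by the Pauli matrices up to sign, with \<open>z\<close> as
  imaginary unit; \<open>z * z = - 1\<close> gives the third one square length 2.\<close>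

lemma COD_exists:
  assumes char: "CHAR('a::field) > 3" and z: "z * z = - (1::'a)"
  shows "\<exists>H :: nat \<Rightarrow> ('a^2^2) set. is_COD H"
proof -
  note nz = small_numerals_nonzero[OF char]
  have z0: "z \<noteq> 0" using z by auto
  define e :: "nat \<Rightarrow> 'a^2^2"
    where "e i = (if i = 0 then mk 1 0 0 else if i = 1 then mk 0 1 1 else mk 0 z (- z))" for i
  have e_simps: "e 0 = mk 1 0 0" "e 1 = mk 0 1 1" "e 2 = mk 0 z (- z)" by (simp_all add: e_def)
  have sl: "e i \<in> sl" for i by (simp add: e_def mk_sl)
  have n: "trf (e i) (e i) = 2" for i by (simp add: e_def trf_mk z)
  have o: "trf (e i) (e j) = 0" if "i \<le> 2" "j \<le> 2" "i \<noteq> j" for i j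
  proof -
    have "i = 0 \<or> i = 1 \<or> i = 2" "j = 0 \<or> j = 1 \<or> j = 2" using that by auto
    thus ?thesis using that(3) by (auto simp: e_def trf_mk)
  qed
  have cc: "classical_cartan (line (e i))" if "i \<le> 2" for i
  proof -
    \<comment> \<open>Any other basis vector can act as the auxiliary vector orthogonal to
      \<open>e i\<close>.\<close>
    obtain j :: nat where "j \<le> 2" "i \<noteq> j" by (metis zero_le le_numeral_extra(3) one_le_numeral zero_neq_one)
    thus ?thesis using line_classical_cartan[OF char sl n sl n] o that by metis
  qed
  have span: "\<exists>f. (\<forall>i\<le>2. f i \<in> line (e i)) \<and> x = (\<Sum>i\<le>2. f i)" if x: "x \<in> sl" for x
  proof -
    \<comment> \<open>The diagonal entry, and the symmetric and antisymmetric parts of the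
      off-diagonal entries.\<close>
    define a where "a i = (if i = 0 then x $ 1 $ 1 else if i = 1 then (x $ 1 $ 2 + x $ 2 $ 1) / 2
      else (x $ 1 $ 2 - x $ 2 $ 1) / (2 * z))" for i :: nat
    have "x = (\<Sum>i\<le>2. smat (a i) (e i))"
      using sl2_nth[OF x] nz z0
      by (simp add: mat_eq_iff forall_2 sum_atMost_2 e_simps a_def del: One_nat_def) (simp add: field_simps)
    thus ?thesis by (intro exI[of _ "\<lambda>i. smat (a i) (e i)"]) (simp add: line_I)
  qed
  have direct: "\<forall>i\<le>2. f i = 0" if f: "\<forall>i\<le>2. f i \<in> line (e i)" and s: "(\<Sum>i\<le>2. f i) = 0" for f
  proof (intro allI impI)
    fix i :: nat assume i: "i \<le> 2"
    have "\<forall>i. \<exists>a. i \<le> 2 \<longrightarrow> f i = smat a (e i)" using f by (metis line_E)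
    then obtain a where a: "\<And>i. i \<le> 2 \<Longrightarrow> f i = smat (a i) (e i)" by metis
    have "i = 0 \<or> i = 1 \<or> i = 2" using i by auto
    \<comment> \<open>By orthogonality this pairing is \<open>a i * 2\<close>.\<close>
    moreover have "trf (f 0 + f 1 + f 2) (e i) = 0" using s by (simp add: sum_atMost_2)
    ultimately have "a i * 2 = 0" using a o n by (auto simp: trf_add)
    thus "f i = 0" using a[OF i] nz(1) by simp
  qed
  have "killing x y = 0" if "i \<le> 2" "j \<le> 2" "i \<noteq> j" "x \<in> line (e i)" "y \<in> line (e j)" for i j x y
    using o[OF that(1-3)] that(4,5) by (auto simp: killing_eq line_def)
  hence "is_COD (\<lambda>i. line (e i))"
    unfolding is_COD_def using cc span direct by simp
  thus ?thesis by blast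
qed

text \<open>Factor \<open>z^4 - 1\<close> as \<open>(z^2 - 1) (z^2 + 1)\<close>; primitivity
  excludes the first factor. Conversely the powers \<open>z\<close>, \<open>-1\<close>,
  \<open>- z\<close> all differ from 1, as \<open>1 \<noteq> - 1\<close>.\<close>

lemma primitive_4_iff:
  assumes "(2::'a::field) \<noteq> 0"
  shows "primitive_root 4 z \<longleftrightarrow> z * z = - (1::'a)"
proof
  assume z: "primitive_root 4 z"
  hence "z ^ 2 \<noteq> 1" "z ^ 4 = 1" by (auto simp: primitive_root_def)
  hence "(z * z - 1) * (z * z + 1) = 0" "z * z \<noteq> 1"
    by (simp_all add: power2_eq_square numeral_eq_Suc algebra_simps)
  thus "z * z = - 1" by (simp add: eq_neg_iff_add_eq_0)
next
  assume z: "z * z = - 1"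
  have ne: "(1::'a) \<noteq> - 1" using assms by (simp add: eq_neg_iff_add_eq_0)
  have p: "z ^ 4 = 1" "z ^ 2 = - 1" "z ^ 3 = - z" using z by (simp_all add: numeral_eq_Suc)
  have "z \<noteq> 1" "z \<noteq> - 1" using z ne by auto
  show "primitive_root 4 z"
    unfolding primitive_root_def
  proof (intro conjI allI impI)
    fix k :: nat assume "0 < k \<and> k < 4"
    hence "k = 1 \<or> k = 2 \<or> k = 3" by auto
    thus "z ^ k \<noteq> 1" using p ne \<open>z \<noteq> 1\<close> \<open>z \<noteq> - 1\<close> by (auto simp: minus_equation_iff)
  qed (rule p)
qed

theorem theorem3p2:
  assumes "CHAR('a::field) > 3"
  shows "((\<exists>H :: nat \<Rightarrow> ('a^2^2) set. is_COD H)
          \<and> (\<forall>H H' :: nat \<Rightarrow> ('a^2^2) set. is_COD H \<longrightarrow> is_COD H' \<longrightarrow> COD_conj H H'))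
         \<longleftrightarrow> (\<exists>z::'a. primitive_root 4 z)"
proof -
  note nz = small_numerals_nonzero[OF assms]
  have "\<exists>z::'a. z * z = - 1" if "is_COD H" for H :: "nat \<Rightarrow> ('a^2^2) set"
  proof -
    obtain c :: 'a and e where "sl2_basis c e" using COD_basis[OF assms \<open>is_COD H\<close>] by blast
    hence "c * c = - 4" by (rule sl2_basis_brackets(1)[OF nz(3)])
    hence "c / 2 * (c / 2) = - 1" using nz by simp
    thus ?thesis by blast
  qed
  moreover have "COD_conj H H'" if "is_COD H" "is_COD H'" "z * z = - (1::'a)"
    for H H' :: "nat \<Rightarrow> ('a^2^2) set" and z
    \<comment> \<open>\<open>2 * z\<close> is a square root of -4, a constant to which bases of both
      decompositions can be adjusted.\<close>
    using COD_conj_if_sqrt[OF assms that(1,2), of "2 * z"] that(3) by (simp add: mult.assoc mult.left_commute)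
  ultimately show ?thesis
    using COD_exists[OF assms] primitive_4_iff[OF nz(1)] by metis
qed

end
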